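(* Let $\varphi(x_1,\ldots,x_n)$ be an expression and $a_1,\ldots,a_n\in\mathrm{M}$ with $|\varphi(a_1,\ldots,a_n)|=|a_i|$ over $\mathrm{M}$, where the variables are indexed so that $|a_1|\le\cdots\le|a_{i-1}|<|a_i|\le\cdots\le|a_n|$. Then, when $\varphi$ is evaluated in the two-element Boolean algebra $\mathrm{B}_2=\{\mathrm{T},\mathrm{F}\}$, the value $\varphi(b_1,\ldots,b_n)$ for $b_1,\ldots,b_n\in\{\mathrm{T},\mathrm{F}\}$ does not depend on $b_1,\ldots,b_{i-1}$ as long as $b_j=p(a_j)$ for every $j\ge i$.
   Context: $\mathrm{M}$ denotes the set $\widehat{\mathbb{Z}}=(\mathbb{Z}\setminus\{0\})\cup\{-\infty,\infty\}$, totally ordered in the usual way, with $a\land b=\min(a,b)$, $a\lor b=\max(a,b)$ and $\lnot a=-a$ (with $|\pm\infty|=\infty$). An expression is a propositional formula built from variables using only $\land,\lor,\lnot$ (no constants), which can be evaluated both in $\mathrm{M}$ and in $\mathrm{B}_2$ with the usual Boolean operations. The map $p:\mathrm{M}\to\mathrm{B}_2$ is $p(a)=\mathrm{F}$ if $a<0$ and $p(a)=\mathrm{T}$ if $a>0$. *)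

theory Defs
  imports Complex_Main "HOL-Library.Extended_Real"
begin

datatype 'v expr =
    Var 'v
  | Neg "'v expr"
  | Conj "'v expr" "'v expr"
  | Disj "'v expr" "'v expr"

primrec vars :: "'v expr \<Rightarrow> 'v set" where
  "vars (Var x) = {x}"
| "vars (Neg e) = vars e"
| "vars (Conj e f) = vars e \<union> vars f"
| "vars (Disj e f) = vars e \<union> vars f"

text \<open>M is represented as a subset of the extended reals, from which it inherits its order,
  negation and absolute value.\<close>

definition M :: "ereal set" where
  "M = ereal ` (\<int> - {0}) \<union> {-\<infinity>, \<infinity>}"

primrec evalM :: "('v \<Rightarrow> ereal) \<Rightarrow> 'v expr \<Rightarrow> ereal" where
  "evalM a (Var x) = a x"
| "evalM a (Neg e) = - evalM a e"
| "evalM a (Conj e f) = min (evalM a e) (evalM a f)"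
| "evalM a (Disj e f) = max (evalM a e) (evalM a f)"

primrec evalB :: "('v \<Rightarrow> bool) \<Rightarrow> 'v expr \<Rightarrow> bool" where
  "evalB b (Var x) = b x"
| "evalB b (Neg e) = (\<not> evalB b e)"
| "evalB b (Conj e f) = (evalB b e \<and> evalB b f)"
| "evalB b (Disj e f) = (evalB b e \<or> evalB b f)"

text \<open>Only used on M, which does not contain 0.\<close>

definition p :: "ereal \<Rightarrow> bool" where
  "p a \<longleftrightarrow> a > 0"

lemma evalM_in_M:
  assumes "\<And>x. x \<in> vars e \<Longrightarrow> a x \<in> M"
  shows "evalM a e \<in> M"
proof -
  have uminus: "- x \<in> M" if "x \<in> M" for x
  proof -
    have "ereal (- r) \<in> ereal ` (\<int> - {0})" if "r \<in> \<int> - {0}" for r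
      using that by (intro imageI) auto
    then show ?thesis using that unfolding M_def by auto
  qed
  show ?thesis
    using assms by (induction e) (auto simp: uminus min_def max_def)
qed

end

theory Submission
  imports Defs
begin

text \<open>Cut M at the level c of the absolute value of the result: values at least c force the
  Boolean value T and values at most -c force F, whatever Boolean values are assigned to the
  variables whose absolute value lies below c. Both halves are needed simultaneously, since
  negation exchanges them.\<close>

lemma evalB_determined_above_level:
  fixes c :: ereal
  assumes "c > 0"
    and "\<And>x. x \<in> vars e \<Longrightarrow> c \<le> \<bar>a x\<bar> \<Longrightarrow> b x = p (a x)"
  shows "(c \<le> evalM a e \<longrightarrow> evalB b e) \<and> (evalM a e \<le> - c \<longrightarrow> \<not> evalB b e)"
  using assms(2)
proof (induction e)
  case (Var x)
  have "b x" if "c \<le> a x"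
    using that Var[of x] \<open>c > 0\<close> by (auto simp: p_def)
  moreover have "\<not> b x" if "a x \<le> - c"
  proof -
    \<comment> \<open>For negative \<open>a x\<close> the absolute value is \<open>- a x\<close>, so
      this bound is what makes the hypothesis on \<open>b\<close> apply to \<open>x\<close>.\<close>
    have "c \<le> - a x"
      using that ereal_minus_le_minus[of "- c" "a x"] by simp
    moreover have "a x < 0"
      using order_le_less_trans[OF that, of 0] \<open>c > 0\<close> by (simp add: ereal_uminus_less_reorder)
    ultimately show ?thesis
      using Var[of x] by (simp add: p_def abs_ereal_less0)
  qed
  ultimately show ?case by simp
next
  case (Neg e)
  then show ?case using ereal_minus_le_minus[of "- c" "evalM a e"] by auto
next
  case (Conj e f)
  \<comment> \<open>A minimum at most \<open>- c\<close> has an argument at most \<open>- c\<close>;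
    that argument alone makes the conjunction false, even if the other lies strictly between
    \<open>- c\<close> and \<open>c\<close>. The disjunction is dual.\<close>
  then show ?case by (auto simp: min_le_iff_disj)
next
  case (Disj e f)
  then show ?case by (auto simp: le_max_iff_disj)
qed

theorem theorem1:
  fixes \<phi> :: "nat expr" and n i :: nat and a :: "nat \<Rightarrow> ereal"
  assumes "vars \<phi> \<subseteq> {1..n}"
    and "\<forall>j\<in>{1..n}. a j \<in> M"
    and "i \<in> {1..n}"
    and "\<bar>evalM a \<phi>\<bar> = \<bar>a i\<bar>"
    and "\<forall>j\<in>{1..n}. \<forall>k\<in>{1..n}. j \<le> k \<longrightarrow> \<bar>a j\<bar> \<le> \<bar>a k\<bar>"
    and "\<forall>j\<in>{1..<i}. \<bar>a j\<bar> < \<bar>a i\<bar>"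
  shows "\<forall>b b' :: nat \<Rightarrow> bool.
    (\<forall>j\<in>{i..n}. b j = p (a j)) \<longrightarrow> (\<forall>j\<in>{i..n}. b' j = p (a j)) \<longrightarrow>
    evalB b \<phi> = evalB b' \<phi>"
proof (intro allI impI)
  fix b b' :: "nat \<Rightarrow> bool"
  assume b: "\<forall>j\<in>{i..n}. b j = p (a j)" and b': "\<forall>j\<in>{i..n}. b' j = p (a j)"
  define c where "c = \<bar>a i\<bar>"
  have "a i \<in> M" using assms(2,3) by blast
  then have c: "c > 0" by (auto simp: c_def M_def)
  \<comment> \<open>The strict inequality below \<open>i\<close> enters here: no variable of index
    less than \<open>i\<close> reaches level \<open>c\<close>.\<close>
  have in_range: "x \<in> {i..n}" if "x \<in> vars \<phi>" "c \<le> \<bar>a x\<bar>" for x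
    using that assms(1,6) by (force simp: c_def not_le[symmetric])
  have determined: "(c \<le> evalM a \<phi> \<longrightarrow> evalB d \<phi>) \<and> (evalM a \<phi> \<le> - c \<longrightarrow> \<not> evalB d \<phi>)"
    if "\<forall>j\<in>{i..n}. d j = p (a j)" for d
    using that in_range by (intro evalB_determined_above_level[OF c]) blast
  \<comment> \<open>The value over M is \<open>c\<close> or \<open>- c\<close>. Which one depends on
    \<open>a\<close> alone, so \<open>b\<close> and \<open>b'\<close> fall under the same half of
    \<open>determined\<close>.\<close>
  have "c \<le> evalM a \<phi> \<or> evalM a \<phi> \<le> - c"
    using assms(4) by (cases "evalM a \<phi> \<ge> 0") (auto simp: c_def[symmetric])
  then show "evalB b \<phi> = evalB b' \<phi>"
    using determined[OF b] determined[OF b'] by blast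
qed

end
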